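(* Let $m$ be an even integer with $m\ge 6$. The symmetric group $S_m$, acting on the set of $2$-element subsets of $\{1,\dots,m\}$, is almost synchronizing.
   Context: For a finite set $X$, the kernel of a map $t:X\to X$ is the partition of $X$ in which $x,y$ lie in the same block iff they have the same image under $t$; a partition is uniform if all its blocks have the same size, and non-uniform otherwise. A primitive permutation group $G$ on $X$ is almost synchronizing if for every map $t:X\to X$ with non-uniform kernel the semigroup $\langle G,t\rangle$ contains a constant map. *)

theory Defs
  imports
    "HOL-Algebra.Sym_Groups"
    "HOL-Algebra.Bij"
    "HOL-Library.Disjoint_Sets"
    "HOL-Library.Ramsey"
begin

text \<open>
  Maps \<open>X \<rightarrow> X\<close> are represented by the extensional functions \<open>X \<rightarrow>\<^sub>E X\<close>, composed by
  \<^const>\<open>compose\<close>. A permutation group on \<open>X\<close> is thus a subgroup of \<^term>\<open>BijGroup X\<close>,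
  identified with its set of elements.
\<close>

definition transitive_perms :: "'a set \<Rightarrow> ('a \<Rightarrow> 'a) set \<Rightarrow> bool" where
  "transitive_perms X G \<longleftrightarrow> (\<forall>x\<in>X. \<forall>y\<in>X. \<exists>g\<in>G. g x = y)"

definition preserves_partition :: "('a \<Rightarrow> 'a) set \<Rightarrow> 'a set set \<Rightarrow> bool" where
  "preserves_partition G P \<longleftrightarrow> (\<forall>g\<in>G. \<forall>B\<in>P. g ` B \<in> P)"

definition primitive_perm_group :: "'a set \<Rightarrow> ('a \<Rightarrow> 'a) set \<Rightarrow> bool" where
  "primitive_perm_group X G \<longleftrightarrow>
     finite X \<and> subgroup G (BijGroup X) \<and> transitive_perms X G \<and>
     (\<forall>P. partition_on X P \<and> preserves_partition G P \<longrightarrow> P = {X} \<or> P = (\<lambda>x. {x}) ` X)"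

definition map_kernel :: "'a set \<Rightarrow> ('a \<Rightarrow> 'a) \<Rightarrow> 'a set set" where
  "map_kernel X t = X // {(x, y). x \<in> X \<and> y \<in> X \<and> t x = t y}"

definition uniform_partition :: "'a set set \<Rightarrow> bool" where
  "uniform_partition P \<longleftrightarrow> (\<forall>A\<in>P. \<forall>B\<in>P. card A = card B)"

inductive_set generated_semigroup :: "'a set \<Rightarrow> ('a \<Rightarrow> 'a) set \<Rightarrow> ('a \<Rightarrow> 'a) set"
  for X :: "'a set" and S :: "('a \<Rightarrow> 'a) set"
where
  incl: "f \<in> S \<Longrightarrow> f \<in> generated_semigroup X S"
| comp: "f \<in> generated_semigroup X S \<Longrightarrow> g \<in> generated_semigroup X S \<Longrightarrow>
         compose X f g \<in> generated_semigroup X S"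

definition almost_synchronizing :: "'a set \<Rightarrow> ('a \<Rightarrow> 'a) set \<Rightarrow> bool" where
  "almost_synchronizing X G \<longleftrightarrow>
     primitive_perm_group X G \<and>
     (\<forall>t\<in>X \<rightarrow>\<^sub>E X. \<not> uniform_partition (map_kernel X t) \<longrightarrow>
        (\<exists>c\<in>X. (\<lambda>x\<in>X. c) \<in> generated_semigroup X (G \<union> {t})))"

definition pairs :: "nat \<Rightarrow> nat set set" where
  "pairs m = nsets {1..m} 2"

text \<open>The permutation group on \<^term>\<open>pairs m\<close> induced by the symmetric group of degree \<open>m\<close>.\<close>

definition sym_group_on_pairs :: "nat \<Rightarrow> (nat set \<Rightarrow> nat set) set" where
  "sym_group_on_pairs m = (\<lambda>p. \<lambda>A\<in>pairs m. p ` A) ` carrier (sym_group m)"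

end

(*
  Suppose that the semigroup T = <G, t> contains no constant map, and let f in T have minimal rank.
  By minimality no map in T identifies two points of the image of f, nor the two points of any
  G-translate of such a pair. Calling two points separated if no map in T identifies them, the
  separated pairs form a G-invariant and T-invariant graph, in which the image of f is a clique and
  for which f is a colouring. Two distinct 2-subsets either meet or are disjoint, and G is
  transitive on each kind of pair; since t is not injective, exactly one kind is separated.

  If the disjoint pairs are separated, then the m(m-1)/2 points are covered by at most m/2 fibres of
  f, each an intersecting family and hence of size at most m-1. So every fibre is the family of all
  2-subsets through some point, but two such families always meet.

  If the meeting pairs are separated, then t maps the star of every v (all 2-subsets through v) onto
  the star of some phi(v). Either phi is injective and so is t, or phi is constant and every fibre
  of t is a perfect matching. In both cases the kernel of t is uniform.
*)

theory Submission
  imports Defs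
begin

section \<open>Partial injections, 2-subsets, stars and intersecting families\<close>

lemma permutes_extends_inj_on:
  assumes "finite X" "S \<subseteq> X" "f ` S \<subseteq> X" "inj_on f S"
  obtains p where "p permutes X" "\<And>x. x \<in> S \<Longrightarrow> p x = f x"
proof -
  have "card (X - S) = card (X - f ` S)"
    using assms by (simp add: card_Diff_subset card_image finite_subset)
  then obtain h where h: "bij_betw h (X - S) (X - f ` S)"
    using assms(1) by (metis finite_Diff finite_same_card_bij)
  define p where "p x = (if x \<in> S then f x else if x \<in> X then h x else x)" for x
  have "bij_betw p S (f ` S)"
    using assms(4) by (auto simp: p_def bij_betw_def inj_on_def)
  moreover have "bij_betw p (X - S) (X - f ` S)"
    using h by (rule bij_betw_cong[THEN iffD1, rotated]) (auto simp: p_def)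
  ultimately have "bij_betw p (S \<union> (X - S)) (f ` S \<union> (X - f ` S))"
    by (rule bij_betw_combine) auto
  then have "bij_betw p X X"
    using assms by (simp add: Un_absorb1)
  then have "p permutes X"
    by (rule bij_imp_permutes) (use assms in \<open>auto simp: p_def\<close>)
  then show thesis
    by (rule that) (simp add: p_def)
qed

lemma in_pairs_iff: "e \<in> pairs m \<longleftrightarrow> (\<exists>a\<in>{1..m}. \<exists>b\<in>{1..m}. a \<noteq> b \<and> e = {a, b})"
  by (auto simp: pairs_def nsets_def card_2_iff)

lemma doubleton_in_pairs [simp]: "{a, b} \<in> pairs m \<longleftrightarrow> a \<in> {1..m} \<and> b \<in> {1..m} \<and> a \<noteq> b"
  by (auto simp: pairs_def nsets_def card_insert_if)

lemma pairsE:
  assumes "e \<in> pairs m" "a \<in> e"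
  obtains b where "a \<in> {1..m}" "b \<in> {1..m}" "a \<noteq> b" "e = {a, b}"
  using assms unfolding in_pairs_iff by blast

lemma finite_pairs [simp]: "finite (pairs m)"
  by (simp add: pairs_def finite_imp_finite_nsets)

lemma card_pairs: "2 * card (pairs m) = m * (m - 1)"
proof -
  have "even (m * (m - 1))"
    by (cases m) auto
  then show ?thesis
    by (simp add: pairs_def choose_two)
qed

definition star :: "nat \<Rightarrow> nat \<Rightarrow> nat set set" where
  "star m v = {e \<in> pairs m. v \<in> e}"

lemma card_star:
  assumes "v \<in> {1..m}"
  shows "card (star m v) = m - 1"
proof -
  have "star m v = (\<lambda>w. {v, w}) ` ({1..m} - {v})"
    using assms by (auto simp: star_def elim!: pairsE)
  moreover have "inj_on (\<lambda>w. {v, w}) ({1..m} - {v})"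
    by (auto simp: inj_on_def doubleton_eq_iff)
  ultimately show ?thesis
    using assms by (simp add: card_image)
qed

lemma finite_star [simp]: "finite (star m v)"
  by (simp add: star_def)

text \<open>The only intersecting families outside all stars are triangles, hence the bound 3. Fix a
  member {a, b}; a member avoiding a and one avoiding b must be {b, c} and {a, c} with the same c. A
  2-subset that meets all three sides of this triangle is itself a side.\<close>

lemma intersecting_pairs_in_star:
  assumes F: "F \<subseteq> pairs m" and int: "\<And>d e. d \<in> F \<Longrightarrow> e \<in> F \<Longrightarrow> d \<inter> e \<noteq> {}"
    and "card F > 3"
  shows "\<exists>v\<in>{1..m}. F \<subseteq> star m v"
proof -
  obtain e where "e \<in> F"
    using assms(3) by fastforce
  then have "e \<in> pairs m"
    using F by blast
  then obtain a b where e: "{a, b} \<in> F" "a \<in> {1..m}" "b \<in> {1..m}"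
    using \<open>e \<in> F\<close> by (auto simp: in_pairs_iff)
  have "F \<subseteq> star m a \<or> F \<subseteq> star m b"
  proof (rule ccontr)
    assume "\<not> ?thesis"
    then obtain e1 e2 where e12: "e1 \<in> F" "a \<notin> e1" "e2 \<in> F" "b \<notin> e2"
      using F by (auto simp: star_def)
    have "b \<in> e1" "a \<in> e2"
      using int[OF e(1) e12(1)] int[OF e(1) e12(3)] e12 by auto
    then obtain c c' where c: "e1 = {b, c}" "e2 = {a, c'}"
      using e12 F by (meson pairsE subsetD)
    have "c' = c"
      using int[OF e12(1,3)] c e12 by auto
    have "F \<subseteq> {{a, b}, {b, c}, {a, c}}"
    proof
      fix d assume "d \<in> F"
      then have "d \<inter> {a, b} \<noteq> {}" "d \<inter> {b, c} \<noteq> {}" "d \<inter> {a, c} \<noteq> {}"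
        using int e e12 c \<open>c' = c\<close> by blast+
      moreover have "d \<in> pairs m"
        using \<open>d \<in> F\<close> F by blast
      then obtain x y where "d = {x, y}"
        by (auto simp: in_pairs_iff)
      moreover have "a \<noteq> b" "a \<noteq> c" "b \<noteq> c"
        using e e12 c \<open>c' = c\<close> F by auto
      ultimately show "d \<in> {{a, b}, {b, c}, {a, c}}"
        by auto
    qed
    then have "card F \<le> card {{a, b}, {b, c}, {a, c}}"
      by (rule card_mono[rotated]) simp
    also have "\<dots> \<le> 3"
      by (simp add: card_insert_if)
    finally show False
      using assms(3) by simp
  qed
  then show ?thesis
    using e(2,3) by blast
qed

section \<open>The induced action: subgroup, orbits on pairs of points, primitivity\<close>

lemma hom_sym_group_on_pairs:
  "(\<lambda>p. \<lambda>A\<in>pairs m. p ` A) \<in> hom (sym_group m) (BijGroup (pairs m))"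
proof -
  let ?h = "\<lambda>p. \<lambda>A\<in>pairs m. p ` A"
  have maps: "p ` A \<in> pairs m" if p: "p permutes {1..m}" and A: "A \<in> pairs m" for p A
  proof -
    obtain a b where "a \<in> {1..m}" "b \<in> {1..m}" "a \<noteq> b" "A = {a, b}"
      using A by (auto simp: in_pairs_iff)
    then show ?thesis
      using permutes_in_image[OF p] permutes_inj[OF p] by (auto simp: inj_eq)
  qed
  have Bij: "?h p \<in> Bij (pairs m)" if p: "p permutes {1..m}" for p
  proof -
    have "bij_betw (\<lambda>A. p ` A) (pairs m) (pairs m)"
    proof (rule bij_betwI[where g = "\<lambda>A. inv_into UNIV p ` A"])
      show "(\<lambda>A. inv_into UNIV p ` A) \<in> pairs m \<rightarrow> pairs m" 
        using maps permutes_inv[OF p] by auto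
    qed (use maps p in \<open>auto simp: image_image permutes_inverses[OF p]\<close>)
    then show ?thesis
      by (simp add: Bij_def cong: bij_betw_cong)
  qed
  show ?thesis
    by (rule homI)
      (auto simp: sym_group_def BijGroup_def Bij compose_def permutes_compose maps image_image
         intro!: ext)
qed

lemma subgroup_sym_group_on_pairs:
  "subgroup (sym_group_on_pairs m) (BijGroup (pairs m))"
proof -
  interpret group_hom "sym_group m" "BijGroup (pairs m)" "\<lambda>p. \<lambda>A\<in>pairs m. p ` A"
    by (simp add: group_hom_def group_hom_axioms_def sym_group_is_group group_BijGroup
        hom_sym_group_on_pairs)
  show ?thesis
    unfolding sym_group_on_pairs_def by (rule img_is_subgroup)
qed

lemma sym_group_on_pairs_funcset:
  "g \<in> sym_group_on_pairs m \<Longrightarrow> g \<in> pairs m \<rightarrow>\<^sub>E pairs m"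
  using subgroup.subset[OF subgroup_sym_group_on_pairs, of m]
  by (auto simp: BijGroup_def PiE_def dest: Bij_imp_extensional Bij_imp_funcset)

text \<open>The source of all the transitivity below: to move one or two 2-subsets it is enough to
  prescribe the permutation injectively on the at most four letters involved.\<close>

lemma sym_group_on_pairs_extends:
  assumes "S \<subseteq> {1..m}" "f ` S \<subseteq> {1..m}" "inj_on f S"
  shows "\<exists>g\<in>sym_group_on_pairs m. \<forall>a\<in>S. \<forall>b\<in>S. a \<noteq> b \<longrightarrow> g {a, b} = {f a, f b}"
proof -
  obtain p where p: "p permutes {1..m}" "\<And>x. x \<in> S \<Longrightarrow> p x = f x"
    using permutes_extends_inj_on[OF _ assms] by blast
  show ?thesis
    by (rule bexI[of _ "\<lambda>A\<in>pairs m. p ` A"])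
      (use p assms(1) in \<open>auto simp: sym_group_on_pairs_def sym_group_def\<close>)
qed

lemma sym_group_on_pairs_transitive:
  assumes "x \<in> pairs m" "y \<in> pairs m"
  shows "\<exists>g\<in>sym_group_on_pairs m. g x = y"
proof -
  obtain a b where x: "a \<in> {1..m}" "b \<in> {1..m}" "a \<noteq> b" "x = {a, b}"
    using assms(1) by (auto simp: in_pairs_iff)
  obtain a' b' where y: "a' \<in> {1..m}" "b' \<in> {1..m}" "a' \<noteq> b'" "y = {a', b'}"
    using assms(2) by (auto simp: in_pairs_iff)
  \<comment> \<open>Here \<open>id\<close> is only a filler: the values outside {a, b} never
    matter.\<close>
  let ?f = "id(a := a', b := b')"
  have "inj_on ?f {a, b}"
    using x(3) y(3) by simp
  then have "\<exists>g\<in>sym_group_on_pairs m. \<forall>u\<in>{a, b}. \<forall>v\<in>{a, b}. u \<noteq> v \<longrightarrow> g {u, v} = {?f u, ?f v}"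
    by (intro sym_group_on_pairs_extends) (use x y in simp_all)
  then show ?thesis
    using x(3,4) y(4) by auto
qed

lemma pairs_meeting_obtain:
  assumes "x \<in> pairs m" "y \<in> pairs m" "x \<noteq> y" "x \<inter> y \<noteq> {}"
  obtains a b c where "a \<in> {1..m}" "b \<in> {1..m}" "c \<in> {1..m}"
    "a \<noteq> b" "a \<noteq> c" "b \<noteq> c" "x = {a, b}" "y = {a, c}"
proof -
  obtain a where "a \<in> x" "a \<in> y"
    using assms by auto
  then obtain b c where "x = {a, b}" "y = {a, c}"
    using assms(1,2) by (meson pairsE)
  then show thesis
    using that assms by auto
qed

text \<open>The common letter goes to the common letter and the two remaining ones follow. With the
  disjoint case below, this shows that the group has at most two orbits on ordered pairs of distinct
  points.\<close>

lemma sym_group_on_pairs_transitive_meeting: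
  assumes "x \<in> pairs m" "y \<in> pairs m" "x \<noteq> y" "x \<inter> y \<noteq> {}"
    and "x' \<in> pairs m" "y' \<in> pairs m" "x' \<noteq> y'" "x' \<inter> y' \<noteq> {}"
  shows "\<exists>g\<in>sym_group_on_pairs m. g x = x' \<and> g y = y'"
proof -
  obtain a b c where x: "a \<in> {1..m}" "b \<in> {1..m}" "c \<in> {1..m}"
    "a \<noteq> b" "a \<noteq> c" "b \<noteq> c" "x = {a, b}" "y = {a, c}"
    using pairs_meeting_obtain[OF assms(1-4)] .
  obtain a' b' c' where y: "a' \<in> {1..m}" "b' \<in> {1..m}" "c' \<in> {1..m}"
    "a' \<noteq> b'" "a' \<noteq> c'" "b' \<noteq> c'" "x' = {a', b'}" "y' = {a', c'}"
    using pairs_meeting_obtain[OF assms(5-8)] .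
  let ?f = "id(a := a', b := b', c := c')"
  have "inj_on ?f {a, b, c}"
    using x(4-6) y(4-6) by simp
  then have "\<exists>g\<in>sym_group_on_pairs m. \<forall>u\<in>{a, b, c}. \<forall>v\<in>{a, b, c}.
      u \<noteq> v \<longrightarrow> g {u, v} = {?f u, ?f v}"
    by (intro sym_group_on_pairs_extends) (use x y in simp_all)
  then show ?thesis
    using x(4-8) y(7,8) by auto
qed

lemma sym_group_on_pairs_transitive_disjoint:
  assumes "x \<in> pairs m" "y \<in> pairs m" "x \<inter> y = {}"
    and "x' \<in> pairs m" "y' \<in> pairs m" "x' \<inter> y' = {}"
  shows "\<exists>g\<in>sym_group_on_pairs m. g x = x' \<and> g y = y'"
proof -
  obtain a b c d where x: "a \<in> {1..m}" "b \<in> {1..m}" "c \<in> {1..m}" "d \<in> {1..m}"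
    "distinct [a, b, c, d]" "x = {a, b}" "y = {c, d}"
    using assms(1-3) by (auto simp: in_pairs_iff)
  obtain a' b' c' d' where y: "a' \<in> {1..m}" "b' \<in> {1..m}" "c' \<in> {1..m}" "d' \<in> {1..m}"
    "distinct [a', b', c', d']" "x' = {a', b'}" "y' = {c', d'}"
    using assms(4-6) by (auto simp: in_pairs_iff)
  let ?f = "id(a := a', b := b', c := c', d := d')"
  have "inj_on ?f {a, b, c, d}"
    using x(5) y(5) by simp
  then have "\<exists>g\<in>sym_group_on_pairs m. \<forall>u\<in>{a, b, c, d}. \<forall>v\<in>{a, b, c, d}.
      u \<noteq> v \<longrightarrow> g {u, v} = {?f u, ?f v}"
    by (intro sym_group_on_pairs_extends) (use x y in simp_all)
  then obtain g where "g \<in> sym_group_on_pairs m" "g {a, b} = {?f a, ?f b}" "g {c, d} = {?f c, ?f d}"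
    using x(5) by (simp only: ball_simps) auto
  then show ?thesis
    using x(5-7) y(6,7) by (intro bexI[of _ g]) simp_all
qed

text \<open>A block with two distinct points relates one meeting or one disjoint pair, and by
  transitivity every pair of that kind. Pairs of the other kind are then joined by a path of length
  two. For disjoint pairs this needs five letters: on four, the 2-subsets and their complements form
  blocks.\<close>

lemma primitive_sym_group_on_pairs:
  assumes "m \<ge> 5"
  shows "primitive_perm_group (pairs m) (sym_group_on_pairs m)"
proof -
  let ?X = "pairs m" and ?G = "sym_group_on_pairs m"
  have "P = {?X} \<or> P = (\<lambda>x. {x}) ` ?X"
    if P: "partition_on ?X P" and pres: "preserves_partition ?G P" for P
  proof (cases "\<exists>B\<in>P. \<exists>x\<in>B. \<exists>y\<in>B. x \<noteq> y")
    case False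
    then have "B = {x}" if "B \<in> P" "x \<in> B" for B x
      using that by blast
    moreover have "B \<noteq> {}" "B \<subseteq> ?X" if "B \<in> P" for B
      using that P by (auto simp: partition_on_def)
    moreover have "\<exists>B\<in>P. x \<in> B" if "x \<in> ?X" for x
      using that P by (auto simp: partition_on_def)
    ultimately have "P = (\<lambda>x. {x}) ` ?X"
      by (auto simp: image_iff) (metis all_not_in_conv subset_iff, metis)
    then show ?thesis ..
  next
    case True
    define R where "R x y \<longleftrightarrow> (\<exists>B\<in>P. x \<in> B \<and> y \<in> B)" for x y
    obtain x y where xy: "R x y" "x \<noteq> y" "x \<in> ?X" "y \<in> ?X"
      using True P unfolding R_def partition_on_def by blast
    have R_refl: "R x x" if "x \<in> ?X" for x
      using that P unfolding R_def partition_on_def by blast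
    have R_trans: "R x z" if "R x y" "R y z" for x y z
      using that partition_onD2[OF P] unfolding R_def disjoint_def by blast
    have R_inv: "R (g x) (g y)" if "g \<in> ?G" "R x y" for g x y
      using that pres unfolding R_def preserves_partition_def by blast
    have all: "R u v" if uv: "u \<in> ?X" "v \<in> ?X" for u v
    proof (cases "x \<inter> y = {}")
      case False
      have meet: "R u v" if uv: "u \<in> ?X" "v \<in> ?X" and uv_meet: "u \<inter> v \<noteq> {}" for u v
      proof (cases "u = v")
        case False
        then obtain g where "g \<in> ?G" "g x = u" "g y = v"
          using sym_group_on_pairs_transitive_meeting[OF xy(3,4,2) \<open>x \<inter> y \<noteq> {}\<close> uv False uv_meet]
          by blast
        then show ?thesis
          using R_inv xy(1) by blast
      qed (use R_refl uv in auto)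
      show ?thesis
      proof (cases "u \<inter> v = {}")
        case True
        obtain a b where ab: "u = {a, b}" "a \<in> {1..m}" "b \<in> {1..m}"
          using uv by (auto simp: in_pairs_iff)
        obtain c d where cd: "v = {c, d}" "c \<in> {1..m}" "d \<in> {1..m}"
          using uv by (auto simp: in_pairs_iff)
        \<comment> \<open>One letter from each of the disjoint points gives a point that meets
          both.\<close>
        have "{a, c} \<in> ?X"
          using True ab cd by auto
        then have "R u {a, c}" "R {a, c} v"
          using ab cd uv by (auto intro!: meet)
        then show ?thesis
          by (rule R_trans)
      qed (use meet uv in auto)
    next
      case disj: True
      have disjoint: "R u v" if uv: "u \<in> ?X" "v \<in> ?X" "u \<inter> v = {}" for u v
      proof -
        obtain g where "g \<in> ?G" "g x = u" "g y = v"
          using sym_group_on_pairs_transitive_disjoint[OF xy(3,4) disj uv] by blast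
        then show ?thesis
          using R_inv xy(1) by blast
      qed
      show ?thesis
      proof (cases "u = v \<or> u \<inter> v = {}")
        case False
        then obtain a b c where abc: "u = {a, b}" "v = {a, c}" "a \<in> {1..m}" "b \<in> {1..m}" "c \<in> {1..m}"
          using pairs_meeting_obtain[OF uv] by metis
        have "card {a, b, c} \<le> 3"
          by (simp add: card_insert_if)
        \<comment> \<open>Two letters remain outside the union of \<open>u\<close> and
          \<open>v\<close>; they form a point disjoint from both.\<close>
        then have "card ({1..m} - {a, b, c}) \<ge> 2"
          using abc assms by (simp add: card_Diff_subset)
        then obtain w where "w \<subseteq> {1..m} - {a, b, c}" "card w = 2"
          by (meson obtain_subset_with_card_n)
        then have "w \<in> ?X" "u \<inter> w = {}" "w \<inter> v = {}"
          using abc by (auto simp: pairs_def nsets_def card_ge_0_finite)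
        then show ?thesis
          using disjoint uv R_trans by metis
      qed (use R_refl disjoint uv in auto)
    qed
    have "B = ?X" if "B \<in> P" for B
    proof -
      have "B \<noteq> {}" "B \<subseteq> ?X"
        using that P by (auto simp: partition_on_def)
      then obtain x where "x \<in> B" "B \<subseteq> ?X"
        by blast
      moreover have "y \<in> B" if "y \<in> ?X" for y
        using all[of x y] that calculation \<open>B \<in> P\<close> partition_onD2[OF P]
        unfolding R_def disjoint_def by blast
      ultimately show ?thesis by auto
    qed
    moreover have "P \<noteq> {}"
      using xy(1) by (auto simp: R_def)
    ultimately show ?thesis
      by auto
  qed
  then show ?thesis
    unfolding primitive_perm_group_def transitive_perms_def
    by (meson finite_pairs subgroup_sym_group_on_pairs sym_group_on_pairs_transitive)
qed

section \<open>Uniform kernels, maps that preserve meeting, and colourings of disjoint pairs\<close>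

lemma map_kernel_eq: "map_kernel X t = (\<lambda>x. {y \<in> X. t y = t x}) ` X"
  by (force simp: map_kernel_def quotient_def)

lemma uniform_map_kernelI:
  assumes "\<And>x. x \<in> X \<Longrightarrow> card {y \<in> X. t y = t x} = n"
  shows "uniform_partition (map_kernel X t)"
  using assms by (auto simp: map_kernel_eq uniform_partition_def)

lemma uniform_map_kernel_if_inj_on:
  assumes "inj_on t X"
  shows "uniform_partition (map_kernel X t)"
proof (rule uniform_map_kernelI)
  fix x assume "x \<in> X"
  then have "{y \<in> X. t y = t x} = {x}"
    using assms by (auto simp: inj_on_def)
  then show "card {y \<in> X. t y = t x} = 1"
    by simp
qed

lemma card_perfect_matching:
  assumes "F \<subseteq> pairs m" "\<And>v. v \<in> {1..m} \<Longrightarrow> \<exists>!e. e \<in> F \<and> v \<in> e"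
  shows "2 * card F = m"
proof -
  have F: "e \<subseteq> {1..m}" "card e = 2" if "e \<in> F" for e
    using that assms(1) by (auto simp: pairs_def nsets_def)
  then have "\<Union>F = {1..m}"
    using assms(2) by blast
  moreover have "c1 \<inter> c2 = {}" if "c1 \<in> F" "c2 \<in> F" "c1 \<noteq> c2" for c1 c2
    using that F(1) assms(2) by blast
  moreover have "finite F"
    using assms(1) finite_pairs by (rule finite_subset)
  ultimately show ?thesis
    using card_partition[of F 2] F by simp
qed

text \<open>The hypotheses make \<open>t\<close> an endomorphism of the triangular graph, the line
  graph of the complete graph on m letters. Stars are its cliques of size m - 1 > 3; their images
  are cliques of the same size, which are again stars.\<close>

lemma uniform_map_kernel_if_preserves_meeting:
  assumes "m \<ge> 5" and t: "t \<in> pairs m \<rightarrow> pairs m"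
    and neq: "\<And>x y. x \<in> pairs m \<Longrightarrow> y \<in> pairs m \<Longrightarrow> x \<noteq> y \<Longrightarrow> x \<inter> y \<noteq> {} \<Longrightarrow> t x \<noteq> t y"
    and meet: "\<And>x y. x \<in> pairs m \<Longrightarrow> y \<in> pairs m \<Longrightarrow> x \<inter> y \<noteq> {} \<Longrightarrow> t x \<inter> t y \<noteq> {}"
  shows "uniform_partition (map_kernel (pairs m) t)"
proof -
  have inj_star: "inj_on t (star m v)" for v
    using neq by (auto simp: inj_on_def star_def)
  have "\<exists>w. t ` star m v = star m w" if v: "v \<in> {1..m}" for v
  proof -
    have card: "card (t ` star m v) = m - 1"
      using card_image[OF inj_star] card_star[OF v] by simp
    moreover have "t ` star m v \<subseteq> pairs m"
      using t by (auto simp: star_def)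
    moreover have "d \<inter> e \<noteq> {}" if "d \<in> t ` star m v" "e \<in> t ` star m v" for d e
      using that meet by (auto simp: star_def disjoint_iff)
    ultimately have "\<exists>w\<in>{1..m}. t ` star m v \<subseteq> star m w"
      using \<open>m \<ge> 5\<close> by (intro intersecting_pairs_in_star) simp_all
    then obtain w where "w \<in> {1..m}" "t ` star m v \<subseteq> star m w"
      by blast
    then show ?thesis
      using card card_star by (metis card_subset_eq finite_star)
  qed
  then obtain \<phi> where \<phi>: "t ` star m v = star m (\<phi> v)" if "v \<in> {1..m}" for v
    by metis
  have \<phi>_in: "\<phi> v \<in> t e" if "e \<in> pairs m" "v \<in> e" for e v
  proof -
    have "v \<in> {1..m}"
      using that by (rule pairsE)
    moreover have "t e \<in> t ` star m v"
      using that by (simp add: star_def)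
    ultimately show ?thesis
      using \<phi> by (simp add: star_def)
  qed
  \<comment> \<open>The 2-subset \<open>t {u, v}\<close> contains both values, so it consists of
    them when they differ.\<close>
  have t_eq: "t {u, v} = {\<phi> u, \<phi> v}" if "{u, v} \<in> pairs m" "\<phi> u \<noteq> \<phi> v" for u v
    using \<phi>_in[OF that(1), of u] \<phi>_in[OF that(1), of v] that(2) funcset_mem[OF t that(1)]
    by (auto simp: in_pairs_iff)
  show ?thesis
  proof (cases "inj_on \<phi> {1..m}")
    case True
    have "inj_on t (pairs m)"
    proof (rule inj_onI)
      fix x y assume xy: "x \<in> pairs m" "y \<in> pairs m" "t x = t y"
      obtain a b where x: "x = {a, b}" "a \<in> {1..m}" "b \<in> {1..m}" "a \<noteq> b"
        using xy(1) by (auto simp: in_pairs_iff)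
      obtain c d where y: "y = {c, d}" "c \<in> {1..m}" "d \<in> {1..m}" "c \<noteq> d"
        using xy(2) by (auto simp: in_pairs_iff)
      \<comment> \<open>For injective \<phi>, \<open>t\<close> is the map induced on 2-subsets by
        \<phi>, so both sides equal \<open>t x\<close>.\<close>
      have "\<phi> ` x = \<phi> ` y"
        using t_eq[of a b] t_eq[of c d] xy x y inj_on_eq_iff[OF True] by auto
      then show "x = y"
        by (rule inj_on_image_eq_iff[OF True, THEN iffD1, rotated 2]) (use x y in auto)
    qed
    then show ?thesis
      by (rule uniform_map_kernel_if_inj_on)
  next
    case False
    then obtain v w where vw: "v \<in> {1..m}" "w \<in> {1..m}" "v \<noteq> w" "\<phi> v = \<phi> w"
      by (auto simp: inj_on_def)
    \<comment> \<open>One coincidence of \<phi> spreads: a letter u with another value would make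
      \<open>t\<close> identify {u, v} and {u, w}, which meet in u.\<close>
    have const: "\<phi> u = \<phi> v" if u: "u \<in> {1..m}" for u
    proof (rule ccontr)
      assume *: "\<phi> u \<noteq> \<phi> v"
      then have uvw: "{u, v} \<in> pairs m" "{u, w} \<in> pairs m"
        using u vw by auto
      then have "t {u, v} = t {u, w}"
        using t_eq[of u v] t_eq[of u w] * vw(4) by simp
      then show False
        using neq[OF uvw] vw(3) by (auto simp: doubleton_eq_iff)
    qed
    show ?thesis
    proof (rule uniform_map_kernelI)
      fix x assume x: "x \<in> pairs m"
      \<comment> \<open>Every star has the same image under \<open>t\<close>, and \<open>t\<close>
        is injective on each star. So each letter lies in exactly one member of the fibre, which is
        therefore a perfect matching.\<close>
      have "2 * card {y \<in> pairs m. t y = t x} = m"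
      proof (rule card_perfect_matching)
        fix u assume u: "u \<in> {1..m}"
        obtain a b where "x = {a, b}" "a \<in> {1..m}"
          using x by (auto simp: in_pairs_iff)
        then have "t x \<in> star m (\<phi> a)"
          using \<phi>_in[OF x, of a] funcset_mem[OF t x] \<open>x = {a, b}\<close> by (simp add: star_def)
        then have "t x \<in> t ` star m u"
          using \<phi>[OF u] const[OF u] const[OF \<open>a \<in> {1..m}\<close>] by simp
        then obtain e where "e \<in> star m u" "t e = t x"
          by (metis imageE)
        then show "\<exists>!e. e \<in> {y \<in> pairs m. t y = t x} \<and> u \<in> e"
          using inj_star[of u] by (intro ex1I[of _ e]) (auto simp: star_def inj_on_def)
      qed auto
      then show "card {y \<in> pairs m. t y = t x} = m div 2"
        by simp
    qed
  qed
qed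

text \<open>By \<open>col\<close>, \<open>f\<close> properly colours the Kneser graph on 2-subsets,
  so its colour classes are intersecting families. By \<open>disj\<close>, the colours are
  themselves pairwise disjoint 2-subsets, which limits their number to m/2. Two colours would then
  have to share a point.\<close>

lemma no_coloring_disjoint_pairs:
  assumes "m \<ge> 5" and f: "f \<in> pairs m \<rightarrow> pairs m"
    and col: "\<And>x y. x \<in> pairs m \<Longrightarrow> y \<in> pairs m \<Longrightarrow> x \<inter> y = {} \<Longrightarrow> f x \<noteq> f y"
    and disj: "disjoint (f ` pairs m)"
  shows "card (f ` pairs m) \<le> 1"
proof (rule ccontr)
  assume not: "\<not> ?thesis"
  let ?X = "pairs m" and ?C = "f ` pairs m"
  let ?F = "\<lambda>c. {x \<in> ?X. f x = c}"
  have C: "e \<subseteq> {1..m}" "card e = 2" if "e \<in> ?C" for e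
    using that f by (auto simp: pairs_def nsets_def)
  have UC: "\<Union>?C \<subseteq> {1..m}"
    using C(1) by blast
  have "2 * card ?C = card (\<Union>?C)"
  proof (rule card_partition)
    show "finite (\<Union>?C)"
      using UC by (rule finite_subset) simp
    show "c1 \<inter> c2 = {}" if "c1 \<in> ?C" "c2 \<in> ?C" "c1 \<noteq> c2" for c1 c2
      using disj that by (rule disjointD)
  qed (use C(2) in simp_all)
  also have "\<dots> \<le> card {1..m}"
    using UC by (intro card_mono) simp_all
  finally have C_le: "2 * card ?C \<le> m"
    by simp
  have fibre: "\<exists>v\<in>{1..m}. ?F c \<subseteq> star m v" if "card (?F c) > 3" for c
  proof (rule intersecting_pairs_in_star)
    show "d \<inter> e \<noteq> {}" if "d \<in> ?F c" "e \<in> ?F c" for d e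
      using that col[of d e] by auto
  qed (use that in auto)
  \<comment> \<open>A fibre with at most 3 members satisfies the bound because m is at least
    5.\<close>
  have le: "card (?F c) \<le> m - 1" for c
  proof (cases "card (?F c) > 3")
    case True
    then obtain v where "v \<in> {1..m}" "?F c \<subseteq> star m v"
      using fibre by blast
    then show ?thesis
      using card_mono[OF finite_star] card_star by metis
  qed (use \<open>m \<ge> 5\<close> in simp)
  have sum: "(\<Sum>c\<in>?C. card (?F c)) = card ?X"
    using sum.image_gen[OF finite_pairs, of "\<lambda>_. 1::nat" m f] by simp
  \<comment> \<open>The count is tight: at most m/2 fibres of size at most m - 1 add up to m(m -
    1)/2, so no fibre can be smaller.\<close>
  have eq: "card (?F c) = m - 1" if "c \<in> ?C" for c
  proof (rule ccontr)
    assume "card (?F c) \<noteq> m - 1"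
    then have "card (?F c) < m - 1"
      using le by (simp add: le_neq_implies_less)
    then have "(\<Sum>c\<in>?C. card (?F c)) < (\<Sum>c\<in>?C. m - 1)"
      using that le by (intro sum_strict_mono_ex1) (simp, blast+)
    then have "2 * card ?X < 2 * card ?C * (m - 1)"
      using sum by simp
    also have "\<dots> \<le> m * (m - 1)"
      using C_le by (rule mult_right_mono) simp
    finally show False
      by (simp add: card_pairs)
  qed
  have star: "\<exists>v\<in>{1..m}. ?F c = star m v" if c: "c \<in> ?C" for c
  proof -
    have "card (?F c) > 3"
      using eq[OF c] \<open>m \<ge> 5\<close> by simp
    then obtain v where "v \<in> {1..m}" "?F c \<subseteq> star m v"
      using fibre by blast
    then show ?thesis
      using eq[OF c] card_star card_subset_eq[OF finite_star] by metis
  qed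
  obtain c d where cd: "c \<in> ?C" "d \<in> ?C" "c \<noteq> d"
    using not card_le_Suc0_iff_eq[of ?C] by auto
  obtain v where v: "v \<in> {1..m}" "?F c = star m v"
    using star[OF cd(1)] by blast
  obtain w where w: "w \<in> {1..m}" "?F d = star m w"
    using star[OF cd(2)] by blast
  \<comment> \<open>The stars of v and w share {v, w}; if v = w, any member of the fibre over c will
    do.\<close>
  obtain x where x: "x \<in> star m v" "x \<in> star m w"
  proof (cases "v = w")
    case True
    obtain x where "x \<in> ?F c"
      using cd(1) by blast
    then show thesis
      using that True v(2) by simp
  next
    case False
    then show thesis
      using that[of "{v, w}"] v(1) w(1) by (simp add: star_def)
  qed
  have "f x = c" "f x = d"
    using x unfolding v(2)[symmetric] w(2)[symmetric] by simp_all
  with cd(3) show False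
    by simp
qed

section \<open>Separated points: the graph of a transformation semigroup, and maps of minimal
  rank\<close>

definition separated :: "('a \<Rightarrow> 'a) set \<Rightarrow> 'a \<Rightarrow> 'a \<Rightarrow> bool" where
  "separated T x y \<longleftrightarrow> (\<forall>h\<in>T. h x \<noteq> h y)"

text \<open>If \<open>h\<close> identified \<open>s x\<close> and \<open>s y\<close>, then
  \<open>compose X h s\<close> would identify \<open>x\<close> and \<open>y\<close>. Membership in
  \<open>X\<close> matters because \<open>compose\<close> is \<open>undefined\<close>
  elsewhere.\<close>

lemma separated_image:
  assumes "separated (generated_semigroup X S) x y" "s \<in> generated_semigroup X S" "x \<in> X" "y \<in> X"
  shows "separated (generated_semigroup X S) (s x) (s y)"
  unfolding separated_def
proof
  fix h assume "h \<in> generated_semigroup X S"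
  then have "compose X h s \<in> generated_semigroup X S"
    using assms(2) by (rule generated_semigroup.comp)
  then have "compose X h s x \<noteq> compose X h s y"
    using assms(1) by (auto simp: separated_def)
  then show "h (s x) \<noteq> h (s y)"
    using assms(3,4) by (simp add: compose_eq)
qed

lemma generated_semigroup_funcset:
  assumes "S \<subseteq> X \<rightarrow>\<^sub>E X" "h \<in> generated_semigroup X S"
  shows "h \<in> X \<rightarrow>\<^sub>E X"
  using assms(2) by induction (use assms(1) in \<open>auto simp: compose_def\<close>)

text \<open>Take \<open>f\<close> of least rank. A map of the semigroup identifying two points of
  its image could be composed with \<open>f\<close> to lower the rank.\<close>

lemma generated_semigroup_min_rank:
  assumes "finite X" "X \<noteq> {}" and S: "S \<subseteq> X \<rightarrow>\<^sub>E X" "S \<noteq> {}"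
    and no_const: "\<And>c. c \<in> X \<Longrightarrow> (\<lambda>x\<in>X. c) \<notin> generated_semigroup X S"
  obtains f where "f \<in> generated_semigroup X S" "card (f ` X) > 1"
    "\<And>x y. x \<in> f ` X \<Longrightarrow> y \<in> f ` X \<Longrightarrow> x \<noteq> y \<Longrightarrow> separated (generated_semigroup X S) x y"
proof -
  let ?T = "generated_semigroup X S"
  obtain s where "s \<in> S"
    using S(2) by blast
  then have "s \<in> ?T"
    by (rule generated_semigroup.incl)
  then have "\<exists>f. f \<in> ?T \<and> (\<forall>h. h \<in> ?T \<longrightarrow> card (f ` X) \<le> card (h ` X))"
    by (rule ex_has_least_nat[where P = "\<lambda>f. f \<in> ?T" and m = "\<lambda>f. card (f ` X)"])
  then obtain f where f: "f \<in> ?T" and min: "\<forall>h. h \<in> ?T \<longrightarrow> card (f ` X) \<le> card (h ` X)"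
    by (elim exE conjE)
  note fX = generated_semigroup_funcset[OF S(1) f]
  have "\<not> card (f ` X) \<le> Suc 0"
  proof
    assume "card (f ` X) \<le> Suc 0"
    then have all_eq: "\<forall>a\<in>f ` X. \<forall>b\<in>f ` X. a = b"
      by (rule card_le_Suc0_iff_eq[THEN iffD1, rotated]) (simp add: \<open>finite X\<close>)
    obtain x where x: "x \<in> X"
      using \<open>X \<noteq> {}\<close> by blast
    \<comment> \<open>Maps are extensional, so an element of rank one is literally a restricted
      constant.\<close>
    have "f = (\<lambda>y\<in>X. f x)"
    proof (rule extensionalityI[of _ X])
      fix y assume "y \<in> X"
      then show "f y = (\<lambda>y\<in>X. f x) y"
        using all_eq x by (metis imageI restrict_apply')
    qed (use fX in \<open>auto simp: PiE_def\<close>)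
    then show False
      using no_const[OF PiE_mem[OF fX x]] f by metis
  qed
  moreover have "separated ?T x y" if xy: "x \<in> f ` X" "y \<in> f ` X" "x \<noteq> y" for x y
    unfolding separated_def
  proof
    fix h assume "h \<in> ?T"
    then have "card (f ` X) \<le> card (compose X h f ` X)"
      using f by (intro min[rule_format] generated_semigroup.comp)
    also have "compose X h f ` X = h ` f ` X"
      by (auto simp: compose_def)
    finally have "inj_on h (f ` X)"
      using \<open>finite X\<close> card_image_le[of "f ` X" h] by (intro eq_card_imp_inj_on) simp_all
    then show "h x \<noteq> h y"
      using xy by (auto simp: inj_on_def)
  qed
  ultimately show thesis
    by (intro that[OF f]) simp_all
qed

section \<open>The dichotomy between disjoint and meeting separated pairs\<close>

theorem theorem8p1:
  fixes m :: nat
  assumes "even m" and "m \<ge> 6"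
  shows "almost_synchronizing (pairs m) (sym_group_on_pairs m)"
proof -
  let ?X = "pairs m" and ?G = "sym_group_on_pairs m"
  have "\<exists>c\<in>?X. (\<lambda>x\<in>?X. c) \<in> generated_semigroup ?X (?G \<union> {t})"
    if t: "t \<in> ?X \<rightarrow>\<^sub>E ?X" and nonuniform: "\<not> uniform_partition (map_kernel ?X t)" for t
  proof (rule ccontr)
    let ?T = "generated_semigroup ?X (?G \<union> {t})"
    assume no_const: "\<not> (\<exists>c\<in>?X. (\<lambda>x\<in>?X. c) \<in> ?T)"
    have sub: "?G \<union> {t} \<subseteq> ?X \<rightarrow>\<^sub>E ?X"
      using t sym_group_on_pairs_funcset by blast
    have "{1, 2} \<in> ?X"
      using assms by simp
    then have "?X \<noteq> {}"
      by blast
    then obtain f where f: "f \<in> ?T" "card (f ` ?X) > 1"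
      and sep: "\<And>x y. x \<in> f ` ?X \<Longrightarrow> y \<in> f ` ?X \<Longrightarrow> x \<noteq> y \<Longrightarrow> separated ?T x y"
      using generated_semigroup_min_rank[of ?X "?G \<union> {t}"] sub no_const by auto
    have fX: "f \<in> ?X \<rightarrow> ?X"
      using generated_semigroup_funcset[OF sub f(1)] by auto
    have tT: "t \<in> ?T"
      by (auto intro: generated_semigroup.incl)
    have GT: "g \<in> ?T" if "g \<in> ?G" for g
      using that by (auto intro: generated_semigroup.incl)
    \<comment> \<open>The group lies in \<open>?T\<close>, so separation is constant on its orbits:
      one separated meeting pair makes all meeting pairs separated.\<close>
    have meeting: "separated ?T u v"
      if "separated ?T x y" "x \<in> ?X" "y \<in> ?X" "x \<noteq> y" "x \<inter> y \<noteq> {}"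
        "u \<in> ?X" "v \<in> ?X" "u \<noteq> v" "u \<inter> v \<noteq> {}" for x y u v
      using sym_group_on_pairs_transitive_meeting[OF that(2-9)]
        separated_image[OF that(1) GT that(2,3)] by auto
    have disjoint: "separated ?T u v"
      if "separated ?T x y" "x \<in> ?X" "y \<in> ?X" "x \<inter> y = {}"
        "u \<in> ?X" "v \<in> ?X" "u \<inter> v = {}" for x y u v
      using sym_group_on_pairs_transitive_disjoint[OF that(2-7)]
        separated_image[OF that(1) GT that(2,3)] by auto
    \<comment> \<open>An injective \<open>t\<close> would have a uniform kernel. The pair identified
      by \<open>t\<close> rules out separation for every pair of its kind.\<close>
    obtain p q where pq: "p \<in> ?X" "q \<in> ?X" "p \<noteq> q" "t p = t q"
      using nonuniform uniform_map_kernel_if_inj_on[of t ?X] by (auto simp: inj_on_def)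
    have npq: "\<not> separated ?T p q"
      using pq(4) tT by (auto simp: separated_def)
    show False
    proof (cases "p \<inter> q = {}")
      case True
      have no_disjoint: "x \<inter> y \<noteq> {}" if "separated ?T x y" "x \<in> ?X" "y \<in> ?X" for x y
        using disjoint[OF that _ pq(1,2) True] npq by blast
      \<comment> \<open>Two points in the image of \<open>f\<close> are separated, hence they meet;
        so all meeting pairs are separated.\<close>
      obtain x y where "x \<in> f ` ?X" "y \<in> f ` ?X" "x \<noteq> y"
        using f(2) card_le_Suc0_iff_eq[of "f ` ?X"] by auto
      then have xy: "separated ?T x y" "x \<in> ?X" "y \<in> ?X" "x \<noteq> y" "x \<inter> y \<noteq> {}"
        using sep no_disjoint fX by blast+
      have image: "separated ?T (t u) (t v)" "t u \<noteq> t v"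
        if "u \<in> ?X" "v \<in> ?X" "u \<noteq> v" "u \<inter> v \<noteq> {}" for u v
        using separated_image[OF meeting[OF xy that] tT that(1,2)] meeting[OF xy that] tT
        by (auto simp: separated_def)
      have "uniform_partition (map_kernel ?X t)"
      proof (rule uniform_map_kernel_if_preserves_meeting)
        show "t u \<inter> t v \<noteq> {}" if "u \<in> ?X" "v \<in> ?X" "u \<inter> v \<noteq> {}" for u v
        \<comment> \<open>Equal points count as meeting here; then it only matters that
          \<open>t u\<close> is nonempty.\<close>
        proof (cases "u = v")
          case True
          then have "t u \<inter> t v \<in> ?X"
            using t \<open>u \<in> ?X\<close> by auto
          then show ?thesis
            by (auto simp: in_pairs_iff)
        next
          case False
          then show ?thesis
            using image(1)[of u v] no_disjoint[of "t u" "t v"] that t by auto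
        qed
      qed (use assms t image(2) in auto)
      with nonuniform show False ..
    next
      case False
      have no_meeting: "x \<inter> y = {}" if "separated ?T x y" "x \<in> ?X" "y \<in> ?X" "x \<noteq> y" for x y
        using meeting[OF that _ pq(1-3) False] npq by blast
      have image_disjoint: "disjoint (f ` ?X)"
        using sep no_meeting fX unfolding disjoint_def by blast
      obtain x y where xy: "x \<in> f ` ?X" "y \<in> f ` ?X" "x \<noteq> y"
        using f(2) card_le_Suc0_iff_eq[of "f ` ?X"] by auto
      have "x \<in> ?X" "y \<in> ?X" "x \<inter> y = {}"
        using xy fX disjointD[OF image_disjoint] by blast+
      \<comment> \<open>All disjoint pairs are separated, and \<open>f\<close> belongs to
        \<open>?T\<close>, so it colours them properly.\<close>
      then have "f u \<noteq> f v" if "u \<in> ?X" "v \<in> ?X" "u \<inter> v = {}" for u v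
        using disjoint[OF sep[OF xy] _ _ _ that] f(1) by (auto simp: separated_def)
      then have "card (f ` ?X) \<le> 1"
        using no_coloring_disjoint_pairs[of m f] assms fX image_disjoint by auto
      with f(2) show False
        by simp
    qed
  qed
  then show ?thesis
    using primitive_sym_group_on_pairs[of m] assms by (auto simp: almost_synchronizing_def)
qed

end
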